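(* Let $\mathcal{O}\subset\mathbb{R}^d$ be an open subset, let $\Sigma\subseteq\partial\mathcal{O}$ be relatively open, and let $\mathfrak{K}\subset C^2(\mathcal{O})$ (respectively, $\mathfrak{K}\subset W^{2,d}_{\mathrm{loc}}(\mathcal{O})$) be a convex cone. Let $Au=-\operatorname{tr}(aD^2u)-\langle b,Du\rangle+cu$ have the weak maximum principle property on $\mathcal{O}\cup\Sigma$ for $\mathfrak{K}$. Suppose that $u,-v\in\mathfrak{K}$. If $Au\le Av$ (a.e.) on $\mathcal{O}$ and $u^*\le v_*$ on $\partial\mathcal{O}\setminus\bar\Sigma$, then $u\le v$ on $\mathcal{O}$. If $Au=Av$ (a.e.) on $\mathcal{O}$ and $u^*=v_*$ on $\partial\mathcal{O}\setminus\bar\Sigma$, then $u=v$ on $\mathcal{O}$ and $u=v\in C(\mathcal{O}\cup(\partial\mathcal{O}\setminus\bar\Sigma))$.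
   Context: $a:\mathcal{O}\to\mathscr{S}^+(d)$ takes values in the non-negative definite symmetric real $d\times d$ matrices, $b:\mathcal{O}\to\mathbb{R}^d$, $c:\mathcal{O}\to\mathbb{R}$; coefficients are everywhere-defined when $\mathfrak{K}\subset C^2(\mathcal{O})$ and measurable when $\mathfrak{K}\subset W^{2,d}_{\mathrm{loc}}(\mathcal{O})$ (in which case inequalities for $Au$ hold a.e.). $u^*$ and $u_*$ denote the upper and lower semicontinuous envelopes on $\bar{\mathcal{O}}$ of $u:\mathcal{O}\to\mathbb{R}$. Weak maximum principle property: $A$ obeys the weak maximum principle property on $\mathcal{O}\cup\Sigma$ for $\mathfrak{K}$ if whenever $u\in\mathfrak{K}$ obeys $Au\le 0$ (a.e.) on $\mathcal{O}$ and $u^*\le 0$ on $\partial\mathcal{O}\setminus\bar\Sigma$, then $u\le 0$ on $\mathcal{O}$.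
   Formalization: The claim is false as stated; the formal version requires that u^* and v_* are never the same infinity on ∂O∖Σ̄ (finite in the equality case) and, for u = v, additionally assumes v^* ≤ u_* on ∂O∖Σ̄ and v − u ∈ K. *)

theory Defs
  imports "HOL-Analysis.Analysis"
begin

text \<open>
  A function on an open set \<open>Om\<close> of \<open>real^'n\<close> (so \<open>d = CARD('n)\<close>) is represented by a total
  function; only its values on \<open>Om\<close> matter.
\<close>

subsection \<open>Semicontinuous envelopes\<close>

text \<open>
  The limits run over all \<open>y \<in> Om\<close> with \<open>y \<rightarrow> x\<close>, the value \<open>y = x\<close> being allowed when \<open>x \<in> Om\<close>.
  At points of \<open>closure Om\<close> the filter is proper and the values may be infinite.
\<close>

definition upper_env :: "'a::topological_space set \<Rightarrow> ('a \<Rightarrow> real) \<Rightarrow> 'a \<Rightarrow> ereal" where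
  "upper_env Om u x = Limsup (inf (nhds x) (principal Om)) (\<lambda>y. ereal (u y))"

definition lower_env :: "'a::topological_space set \<Rightarrow> ('a \<Rightarrow> real) \<Rightarrow> 'a \<Rightarrow> ereal" where
  "lower_env Om u x = Liminf (inf (nhds x) (principal Om)) (\<lambda>y. ereal (u y))"

text \<open>\<open>u\<close>, given on \<open>Om\<close>, belongs to \<open>C(T)\<close> for a set \<open>T\<close> with \<open>Om \<subseteq> T \<subseteq> closure Om\<close>.\<close>

definition extends_continuously ::
  "'a::topological_space set \<Rightarrow> 'a set \<Rightarrow> ('a \<Rightarrow> real) \<Rightarrow> bool" where
  "extends_continuously Om T u \<longleftrightarrow>
     (\<exists>g :: 'a \<Rightarrow> real. continuous_on T g \<and> (\<forall>x\<in>Om. g x = u x))"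


subsection \<open>Convex cones of functions\<close>

text \<open>Only positive scalars are required, so that the zero function need not belong to the cone.\<close>

definition convex_cone_of_functions :: "('a \<Rightarrow> real) set \<Rightarrow> bool" where
  "convex_cone_of_functions K \<longleftrightarrow>
     (\<forall>f\<in>K. \<forall>g\<in>K. \<forall>s>0. \<forall>t>0. (\<lambda>x. s * f x + t * g x) \<in> K)"


subsection \<open>Classical derivatives\<close>

definition partial :: "'n \<Rightarrow> (real^'n \<Rightarrow> real) \<Rightarrow> real^'n::finite \<Rightarrow> real" where
  "partial i f x = frechet_derivative f (at x) (axis i 1)"

definition grad :: "(real^'n::finite \<Rightarrow> real) \<Rightarrow> real^'n \<Rightarrow> real^'n" where
  "grad f x = (\<chi> i. partial i f x)"

definition hess :: "(real^'n::finite \<Rightarrow> real) \<Rightarrow> real^'n \<Rightarrow> real^'n^'n" where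
  "hess f x = (\<chi> i j. partial j (partial i f) x)"

definition C2 :: "(real^'n::finite) set \<Rightarrow> (real^'n \<Rightarrow> real) set" where
  "C2 Om = {f. (\<forall>x\<in>Om. f differentiable at x) \<and>
               (\<forall>i. \<forall>x\<in>Om. partial i f differentiable at x) \<and>
               (\<forall>i j. continuous_on Om (partial j (partial i f)))}"


subsection \<open>Weak derivatives and the local Sobolev space of order \<open>2\<close> and exponent \<open>d\<close>\<close>

fun Ck :: "nat \<Rightarrow> (real^'n::finite \<Rightarrow> real) \<Rightarrow> bool" where
  "Ck 0 f \<longleftrightarrow> continuous_on UNIV f"
| "Ck (Suc k) f \<longleftrightarrow> (\<forall>x. f differentiable at x) \<and> (\<forall>i. Ck k (partial i f))"

definition test_functions :: "(real^'n::finite) set \<Rightarrow> (real^'n \<Rightarrow> real) set" where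
  "test_functions Om =
     {\<phi>. (\<forall>k. Ck k \<phi>) \<and> compact (closure {x. \<phi> x \<noteq> 0}) \<and> closure {x. \<phi> x \<noteq> 0} \<subseteq> Om}"

definition weak_partial ::
  "(real^'n::finite) set \<Rightarrow> 'n \<Rightarrow> (real^'n \<Rightarrow> real) \<Rightarrow> (real^'n \<Rightarrow> real) \<Rightarrow> bool" where
  "weak_partial Om i f g \<longleftrightarrow>
     (\<forall>\<phi>\<in>test_functions Om.
        (LINT x|lebesgue_on Om. f x * partial i \<phi> x) = - (LINT x|lebesgue_on Om. g x * \<phi> x))"

definition Ld_loc :: "(real^'n::finite) set \<Rightarrow> (real^'n \<Rightarrow> real) set" where
  "Ld_loc Om = {f. f \<in> borel_measurable (lebesgue_on Om) \<and>
     (\<forall>C. compact C \<and> C \<subseteq> Om \<longrightarrow> integrable (lebesgue_on C) (\<lambda>x. \<bar>f x\<bar> ^ CARD('n)))}"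

definition has_W2d_derivs ::
  "(real^'n::finite) set \<Rightarrow> (real^'n \<Rightarrow> real) \<Rightarrow> (real^'n \<Rightarrow> real^'n) \<Rightarrow> (real^'n \<Rightarrow> real^'n^'n) \<Rightarrow> bool"
  where
  "has_W2d_derivs Om f G H \<longleftrightarrow>
     f \<in> Ld_loc Om \<and>
     (\<forall>i. (\<lambda>x. G x $ i) \<in> Ld_loc Om \<and> weak_partial Om i f (\<lambda>x. G x $ i)) \<and>
     (\<forall>i j. (\<lambda>x. H x $ i $ j) \<in> Ld_loc Om \<and>
            weak_partial Om j (\<lambda>x. G x $ i) (\<lambda>x. H x $ i $ j))"

text \<open>
  Every class in this Sobolev space has a unique continuous representative (Sobolev embedding),
  and it is this representative whose pointwise values and envelopes are meant.
\<close>

definition W2d_loc :: "(real^'n::finite) set \<Rightarrow> (real^'n \<Rightarrow> real) set" where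
  "W2d_loc Om = {f. continuous_on Om f \<and> (\<exists>G H. has_W2d_derivs Om f G H)}"


subsection \<open>The operator\<close>

definition coeff_nonneg :: "(real^'n::finite) set \<Rightarrow> (real^'n \<Rightarrow> real^'n^'n) \<Rightarrow> bool" where
  "coeff_nonneg Om a \<longleftrightarrow>
     (\<forall>x\<in>Om. transpose (a x) = a x \<and> (\<forall>\<xi>. 0 \<le> \<xi> \<bullet> (a x *v \<xi>)))"

definition op_expr ::
  "(real^'n::finite \<Rightarrow> real^'n^'n) \<Rightarrow> (real^'n \<Rightarrow> real^'n) \<Rightarrow> (real^'n \<Rightarrow> real) \<Rightarrow>
   (real^'n \<Rightarrow> real) \<Rightarrow> (real^'n \<Rightarrow> real^'n) \<Rightarrow> (real^'n \<Rightarrow> real^'n^'n) \<Rightarrow> real^'n \<Rightarrow> real" where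
  "op_expr a b c f G H x = - trace (a x ** H x) - b x \<bullet> G x + c x * f x"

definition classical_op ::
  "(real^'n::finite \<Rightarrow> real^'n^'n) \<Rightarrow> (real^'n \<Rightarrow> real^'n) \<Rightarrow> (real^'n \<Rightarrow> real) \<Rightarrow>
   (real^'n \<Rightarrow> real) \<Rightarrow> real^'n \<Rightarrow> real" where
  "classical_op a b c f = op_expr a b c f (grad f) (hess f)"

text \<open>
  \<open>F\<close> is a version of \<open>Af\<close>, for \<open>f\<close> in the Sobolev space. Weak derivatives, and hence \<open>F\<close>, are
  determined up to a null set of \<open>Om\<close>, so properties that hold almost everywhere do not depend
  on the version.
\<close>

definition has_strong_op ::
  "(real^'n::finite) set \<Rightarrow> (real^'n \<Rightarrow> real^'n^'n) \<Rightarrow> (real^'n \<Rightarrow> real^'n) \<Rightarrow> (real^'n \<Rightarrow> real) \<Rightarrow>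
   (real^'n \<Rightarrow> real) \<Rightarrow> (real^'n \<Rightarrow> real) \<Rightarrow> bool" where
  "has_strong_op Om a b c f F \<longleftrightarrow> (\<exists>G H. has_W2d_derivs Om f G H \<and> F = op_expr a b c f G H)"


subsection \<open>The weak maximum principle property on \<open>Om \<union> S\<close> for \<open>K\<close>\<close>

definition weak_max_principle_C2 where
  "weak_max_principle_C2 Om S K a b c \<longleftrightarrow>
     (\<forall>w\<in>K. (\<forall>x\<in>Om. classical_op a b c w x \<le> 0) \<and>
            (\<forall>x\<in>frontier Om - closure S. upper_env Om w x \<le> 0) \<longrightarrow>
            (\<forall>x\<in>Om. w x \<le> 0))"

definition weak_max_principle_W2d where
  "weak_max_principle_W2d Om S K a b c \<longleftrightarrow>
     (\<forall>w\<in>K. \<forall>F. has_strong_op Om a b c w F \<and> (AE x in lebesgue_on Om. F x \<le> 0) \<and>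
            (\<forall>x\<in>frontier Om - closure S. upper_env Om w x \<le> 0) \<longrightarrow>
            (\<forall>x\<in>Om. w x \<le> 0))"


subsection \<open>Boundary inequalities\<close>

text \<open>
  \<open>u\<^sup>* \<le> v\<^sub>*\<close> on \<open>B\<close>, as it is needed to conclude \<open>(u - v)\<^sup>* \<le> u\<^sup>* - v\<^sub>* \<le> 0\<close>: the expressions
  \<open>\<infinity> - \<infinity>\<close> and \<open>(- \<infinity>) - (- \<infinity>)\<close> are excluded. Given \<open>u\<^sup>* \<le> v\<^sub>*\<close>, the two strict inequalities say
  exactly that \<open>u\<^sup>*\<close> and \<open>v\<^sub>*\<close> are not the same infinity. If \<open>v = 0\<close>, they are implied by
  \<open>u\<^sup>* \<le> 0\<close>. Without them \<open>u = v + 1\<close> with \<open>v = \<infinity>\<close> on the boundary would be a counterexample to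
  the comparison principle.
\<close>

definition env_le_on ::
  "'a::topological_space set \<Rightarrow> 'a set \<Rightarrow> ('a \<Rightarrow> real) \<Rightarrow> ('a \<Rightarrow> real) \<Rightarrow> bool" where
  "env_le_on Om B u v \<longleftrightarrow>
     (\<forall>x\<in>B. upper_env Om u x < \<infinity> \<and> - \<infinity> < lower_env Om v x \<and>
            upper_env Om u x \<le> lower_env Om v x)"

text \<open>\<open>u\<^sup>* = v\<^sub>*\<close> on \<open>B\<close>, the common value being finite.\<close>

definition env_eq_on ::
  "'a::topological_space set \<Rightarrow> 'a set \<Rightarrow> ('a \<Rightarrow> real) \<Rightarrow> ('a \<Rightarrow> real) \<Rightarrow> bool" where
  "env_eq_on Om B u v \<longleftrightarrow>
     (\<forall>x\<in>B. \<bar>upper_env Om u x\<bar> \<noteq> \<infinity> \<and> upper_env Om u x = lower_env Om v x)"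

text \<open>
  For uniqueness the roles of \<open>u\<close> and \<open>v\<close> are exchanged in the comparison principle. The hypotheses
  \<open>u, -v \<in> K\<close> and \<open>u\<^sup>* = v\<^sub>*\<close> are not symmetric in \<open>u\<close> and \<open>v\<close>, and do not by themselves imply
  \<open>u = v\<close>: for the Laplacian on the unit disc and \<open>K = C2\<close>, minus a Poisson kernel \<open>u\<close> and \<open>v = 0\<close>
  have \<open>u\<^sup>* = v\<^sub>* = 0\<close> on the circle; for \<open>-w'' - w\<close> on \<open>(0,\<pi>)\<close> and the cone of nonnegative multiples
  of \<open>-sin\<close>, so do \<open>u = -sin\<close> and \<open>v = sin\<close> at the end points. Therefore uniqueness is stated with
  \<open>v\<^sup>* \<le> u\<^sub>*\<close> and \<open>v - u \<in> K\<close> in addition.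
\<close>

end

theory Submission
  imports Defs
begin

text \<open>
  The comparison principle is the weak maximum principle applied to the one function \<open>w = u - v\<close>.
  It lies in the cone as the sum of \<open>u\<close> and \<open>-v\<close>; the operator is linear, so \<open>Aw = Au - Av \<le> 0\<close>;
  and on the boundary \<open>w\<^sup>* \<le> u\<^sup>* - v\<^sub>* \<le> 0\<close>, where the difference makes sense because the two
  envelopes are not the same infinity (\<open>upper_env_diff_le_zero\<close>). Linearity of the operator is
  where the two function classes differ. For classical derivatives it uses openness of the domain, so
  that identities between first partial derivatives can be differentiated once more
  (\<open>classical_op_diff\<close>). For weak derivatives the point is that both sides of the integration by
  parts formula are integrals of integrable functions and hence additive: a locally \<open>L\<^sup>d\<close> function
  is locally \<open>L\<^sup>1\<close>, and a test function and its partial derivatives are bounded and vanish off a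
  compact subset of the domain (\<open>has_strong_op_diff\<close>, resting on \<open>test_function_integrable\<close>).
  
  For uniqueness the comparison principle is used in both directions, which gives \<open>u = v\<close>. At a
  boundary point this turns \<open>u\<^sup>* = v\<^sub>*\<close> into \<open>u\<^sup>* = u\<^sub>*\<close>, a finite number, so that \<open>u\<close> has a
  limit there along the domain. A function that has a limit along its domain at every point of a
  larger set inside the closure extends continuously to that set
  (\<open>extends_continuously_if_limits_exist\<close>), which is the asserted continuity up to the boundary.
\<close>

section \<open>Semicontinuous envelopes and continuous extension\<close>

text \<open>
  A real number \<open>r\<close> fits between \<open>u\<^sup>*\<close> and \<open>v\<^sub>*\<close>, even if either is infinite. Near the point,
  \<open>u\<close> stays below \<open>r + e/2\<close> and \<open>v\<close> above \<open>r - e/2\<close>, whence \<open>u - v < e\<close>. Passing through \<open>r\<close>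
  avoids all subtraction of extended reals.
\<close>

lemma upper_env_diff_le_zero:
  fixes u v :: "'a::topological_space \<Rightarrow> real"
  assumes "upper_env Om u x < \<infinity>" and "- \<infinity> < lower_env Om v x"
    and le: "upper_env Om u x \<le> lower_env Om v x"
  shows "upper_env Om (\<lambda>y. u y - v y) x \<le> 0"
proof -
  let ?F = "inf (nhds x) (principal Om)"
  obtain r :: real where r: "upper_env Om u x \<le> ereal r" "ereal r \<le> lower_env Om v x"
  proof (cases "upper_env Om u x" "lower_env Om v x" rule: ereal2_cases)
    case real_real then show ?thesis using that le by auto
  next
    case MInf_real then show ?thesis using that by auto
  next
    case real_PInf then show ?thesis using that by auto
  next
    case MInf_PInf then show ?thesis using that[of 0] by auto
  qed (use assms in auto)
  have "upper_env Om (\<lambda>y. u y - v y) x \<le> 0 + ereal e" if "0 < e" for e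
  proof -
    have "upper_env Om u x < ereal (r + e / 2)"
      using r(1) that by (auto elim!: order.strict_trans1)
    then have U: "eventually (\<lambda>y. ereal (u y) < ereal (r + e / 2)) ?F"
      unfolding upper_env_def by (rule Limsup_lessD)
    have "ereal (r - e / 2) < lower_env Om v x"
      by (rule order.strict_trans2[OF _ r(2)]) (use that in auto)
    then have V: "eventually (\<lambda>y. ereal (r - e / 2) < ereal (v y)) ?F"
      unfolding lower_env_def by (rule less_LiminfD)
    have "eventually (\<lambda>y. ereal (u y - v y) \<le> ereal e) ?F"
      using U V by eventually_elim (auto simp: field_simps)
    then have "upper_env Om (\<lambda>y. u y - v y) x \<le> ereal e"
      unfolding upper_env_def by (rule Limsup_bounded)
    then show ?thesis by simp
  qed
  then show ?thesis by (rule ereal_le_epsilon2)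
qed

lemma envelope_filter_nontrivial:
  assumes "x \<in> closure Om"
  shows "inf (nhds x) (principal Om) \<noteq> bot"
  using assms
  by (auto simp: trivial_limit_def eventually_inf_principal eventually_nhds closure_iff_nhds_not_empty)

lemma tendsto_if_envelopes_agree:
  fixes u :: "'a::topological_space \<Rightarrow> real"
  assumes "x \<in> closure Om" and "\<bar>upper_env Om u x\<bar> \<noteq> \<infinity>"
    and "upper_env Om u x = lower_env Om u x"
  shows "\<exists>l. (u \<longlongrightarrow> l) (inf (nhds x) (principal Om))"
proof -
  let ?F = "inf (nhds x) (principal Om)"
  obtain l where l: "upper_env Om u x = ereal l"
    using assms(2) by auto
  have "((\<lambda>y. ereal (u y)) \<longlongrightarrow> ereal l) ?F"
    unfolding tendsto_iff_Liminf_eq_Limsup[OF envelope_filter_nontrivial[OF assms(1)]]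
    using l assms(3) by (simp add: upper_env_def lower_env_def)
  then show ?thesis by auto
qed

lemma continuous_on_imp_tendsto_relative:
  assumes "continuous_on Om u" and "x \<in> Om"
  shows "(u \<longlongrightarrow> u x) (inf (nhds x) (principal Om))"
  using assms by (fastforce simp: tendsto_def continuous_on_topological eventually_inf_principal eventually_nhds)

text \<open>
  The extension assigns to each point the limit of \<open>u\<close> there. It is continuous because the target is
  a regular space: if \<open>u\<close> stays within \<open>e/2\<close> of the limit at \<open>x\<close> on a neighbourhood of \<open>x\<close>, then
  so do the limits of \<open>u\<close> at all other points of that neighbourhood.
\<close>

lemma extends_continuously_if_limits_exist:
  fixes u :: "'a::topological_space \<Rightarrow> real"
  assumes "Om \<subseteq> T" and "T \<subseteq> closure Om"
    and lim: "\<And>x. x \<in> T \<Longrightarrow> \<exists>l. (u \<longlongrightarrow> l) (inf (nhds x) (principal Om))"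
  shows "extends_continuously Om T u"
proof -
  obtain g where g: "\<And>x. x \<in> T \<Longrightarrow> (u \<longlongrightarrow> g x) (inf (nhds x) (principal Om))"
    using lim by metis
  have "g x = u x" if "x \<in> Om" for x
  proof -
    \<comment> \<open>The filter admits \<open>y = x\<close> when \<open>x \<in> Om\<close>, so a limit of \<open>u\<close> there can only be \<open>u x\<close>.\<close>
    have "principal {x} \<le> inf (nhds x) (principal Om)"
      using that by (auto simp: le_filter_def eventually_inf_principal eventually_principal
          dest: eventually_nhds_x_imp_x)
    with g[of x] that assms(1) have "(u \<longlongrightarrow> g x) (principal {x})"
      by (blast intro: tendsto_mono)
    moreover have "(u \<longlongrightarrow> u x) (principal {x})"
      by (rule tendsto_principal_singleton)
    ultimately show ?thesis
      by (intro tendsto_unique[of "principal {x}"]) (auto simp: principal_eq_bot_iff)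
  qed
  moreover have "continuous_on T g"
    unfolding continuous_on_def
  proof (intro ballI tendstoI)
    fix x and e :: real
    assume x: "x \<in> T" and e: "0 < e"
    have "eventually (\<lambda>y. dist (u y) (g x) < e / 2) (inf (nhds x) (principal Om))"
      using tendstoD[OF g[OF x], of "e / 2"] e by linarith
    then obtain W where W: "open W" "x \<in> W" "\<And>y. y \<in> W \<Longrightarrow> y \<in> Om \<Longrightarrow> dist (u y) (g x) < e / 2"
      by (auto simp: eventually_inf_principal eventually_nhds)
    have "dist (g y) (g x) < e" if y: "y \<in> W" "y \<in> T" for y
    proof -
      have "eventually (\<lambda>z. dist (u z) (g x) \<le> e / 2) (inf (nhds y) (principal Om))"
        using W y(1) by (force simp: eventually_inf_principal eventually_nhds)
      moreover have "((\<lambda>z. dist (u z) (g x)) \<longlongrightarrow> dist (g y) (g x)) (inf (nhds y) (principal Om))"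
        using g[OF y(2)] by (intro tendsto_intros)
      ultimately have "dist (g y) (g x) \<le> e / 2"
        using tendsto_upperbound envelope_filter_nontrivial y(2) assms(2) by blast
      with e show ?thesis by simp
    qed
    with W(1,2) show "eventually (\<lambda>y. dist (g y) (g x) < e) (at x within T)"
      by (auto simp: eventually_at_topological)
  qed
  ultimately show ?thesis
    unfolding extends_continuously_def by blast
qed

lemma lower_env_cong:
  assumes "\<And>y. y \<in> Om \<Longrightarrow> u y = v y"
  shows "lower_env Om u x = lower_env Om v x"
  unfolding lower_env_def
  by (rule Liminf_eq) (use assms in \<open>auto simp: eventually_inf_principal\<close>)

text \<open>
  Lower envelopes depend only on values in \<open>Om\<close>, so \<open>u = v\<close> there replaces \<open>v\<^sub>*\<close> by \<open>u\<^sub>*\<close>. With its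
  two envelopes equal and finite, \<open>u\<close> has a limit at each point of \<open>B\<close>.
\<close>

lemma extends_continuously_by_envelopes:
  fixes u v :: "'a::topological_space \<Rightarrow> real"
  assumes "continuous_on Om u" and uv: "\<And>x. x \<in> Om \<Longrightarrow> u x = v x"
    and "B \<subseteq> closure Om" and "env_eq_on Om B u v"
  shows "extends_continuously Om (Om \<union> B) u"
proof (rule extends_continuously_if_limits_exist)
  show "Om \<subseteq> Om \<union> B" by blast
  show "Om \<union> B \<subseteq> closure Om" using assms(3) closure_subset by blast
  fix x assume "x \<in> Om \<union> B"
  then consider "x \<in> Om" | "x \<in> B" by blast
  then show "\<exists>l. (u \<longlongrightarrow> l) (inf (nhds x) (principal Om))"
  proof cases
    case 1
    then show ?thesis using continuous_on_imp_tendsto_relative[OF assms(1)] by blast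
  next
    case 2
    with assms(4) have "\<bar>upper_env Om u x\<bar> \<noteq> \<infinity>" "upper_env Om u x = lower_env Om u x"
      using lower_env_cong[of Om u v x] uv by (auto simp: env_eq_on_def)
    with 2 assms(3) show ?thesis by (intro tendsto_if_envelopes_agree) auto
  qed
qed

lemma env_eq_imp_le: "env_eq_on Om B u v \<Longrightarrow> env_le_on Om B u v"
  by (fastforce simp: env_eq_on_def env_le_on_def)

section \<open>Linearity of the operator\<close>

lemma op_expr_diff:
  "op_expr a b c (\<lambda>y. f y - g y) (\<lambda>y. G y - G' y) (\<lambda>y. H y - H' y) x =
     op_expr a b c f G H x - op_expr a b c g G' H' x"
  by (simp add: op_expr_def trace_def matrix_matrix_mult_def sum_subtractf inner_diff_right
      algebra_simps)

lemma partial_diff: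
  assumes "f differentiable at x" and "g differentiable at x"
  shows "partial i (\<lambda>y. f y - g y) x = partial i f x - partial i g x"
proof -
  have "((\<lambda>y. f y - g y) has_derivative
          (\<lambda>h. frechet_derivative f (at x) h - frechet_derivative g (at x) h)) (at x)"
    using assms by (intro derivative_intros) (auto simp: frechet_derivative_works)
  then show ?thesis
    unfolding partial_def by (simp add: frechet_derivative_at[symmetric])
qed

lemma has_derivative_cong_open:
  assumes "open Om" and "x \<in> Om" and "\<And>y. y \<in> Om \<Longrightarrow> f y = g y"
  shows "(f has_derivative D) (at x) \<longleftrightarrow> (g has_derivative D) (at x)"
  using assms by (metis has_derivative_transform_within_open)

lemma differentiable_cong_open:
  assumes "open Om" and "x \<in> Om" and "\<And>y. y \<in> Om \<Longrightarrow> f y = g y"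
  shows "f differentiable at x \<longleftrightarrow> g differentiable at x"
proof -
  have "(f has_derivative D) (at x) \<longleftrightarrow> (g has_derivative D) (at x)" for D
    by (rule has_derivative_cong_open[OF assms])
  then show ?thesis unfolding differentiable_def by simp
qed

lemma partial_cong_open:
  assumes "open Om" and "x \<in> Om" and "\<And>y. y \<in> Om \<Longrightarrow> f y = g y"
  shows "partial i f x = partial i g x"
proof -
  have "(f has_derivative D) (at x) \<longleftrightarrow> (g has_derivative D) (at x)" for D
    by (rule has_derivative_cong_open[OF assms])
  then show ?thesis unfolding partial_def frechet_derivative_def by simp
qed

text \<open>
  The formula for the first partial derivatives of a difference holds throughout the open set and not
  just at \<open>x\<close>. This is what allows it to be differentiated again.
\<close>

lemma C2_diff_at:
  assumes "open Om" and "f \<in> C2 Om" and "g \<in> C2 Om" and x: "x \<in> Om"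
  shows C2_grad_diff: "grad (\<lambda>y. f y - g y) x = grad f x - grad g x"
    and C2_second_diff: "partial j (partial i (\<lambda>y. f y - g y)) x =
                           partial j (partial i f) x - partial j (partial i g) x"
    and C2_partial_differentiable: "partial i (\<lambda>y. f y - g y) differentiable at x"
proof -
  have 1: "partial i (\<lambda>y. f y - g y) y = partial i f y - partial i g y" if "y \<in> Om" for y i
    using assms that by (intro partial_diff) (auto simp: C2_def)
  then show "grad (\<lambda>y. f y - g y) x = grad f x - grad g x"
    using x by (simp add: grad_def vec_eq_iff)
  have d: "partial i f differentiable at x" "partial i g differentiable at x"
    using assms by (auto simp: C2_def)
  show "partial i (\<lambda>y. f y - g y) differentiable at x"
    using differentiable_cong_open[OF assms(1) x 1] d by (auto intro: differentiable_diff)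
  show "partial j (partial i (\<lambda>y. f y - g y)) x =
          partial j (partial i f) x - partial j (partial i g) x"
    using partial_cong_open[OF assms(1) x 1] partial_diff[OF d] by simp
qed

lemma C2_diff:
  assumes "open Om" and "f \<in> C2 Om" and "g \<in> C2 Om"
  shows "(\<lambda>x. f x - g x) \<in> C2 Om"
proof -
  have "continuous_on Om (partial j (partial i (\<lambda>y. f y - g y)))" for i j
  proof -
    have "continuous_on Om (\<lambda>x. partial j (partial i f) x - partial j (partial i g) x)"
      using assms by (intro continuous_intros) (auto simp: C2_def)
    then show ?thesis
      by (rule continuous_on_eq) (simp add: C2_second_diff[OF assms])
  qed
  then show ?thesis
    using assms C2_partial_differentiable[OF assms] by (auto simp: C2_def)
qed

text \<open>
  The hypotheses place \<open>-v\<close> in the cone; this recovers the regularity of \<open>v\<close> itself.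
\<close>

lemma C2_uminus_cancel:
  assumes "open Om" and "(\<lambda>x. - f x) \<in> C2 Om"
  shows "f \<in> C2 Om"
proof -
  have [simp]: "partial i (\<lambda>x. 0) = (\<lambda>x. 0)" for i :: 'a
    by (auto simp: partial_def)
  have "(\<lambda>x. 0) \<in> C2 Om"
    by (simp add: C2_def)
  from C2_diff[OF assms(1) this assms(2)] show ?thesis by simp
qed

lemma classical_op_diff:
  assumes "open Om" and "f \<in> C2 Om" and "g \<in> C2 Om" and "x \<in> Om"
  shows "classical_op a b c (\<lambda>y. f y - g y) x = classical_op a b c f x - classical_op a b c g x"
proof -
  have "hess (\<lambda>y. f y - g y) x = hess f x - hess g x"
    using C2_second_diff[OF assms] by (simp add: hess_def vec_eq_iff)
  with C2_grad_diff[OF assms] op_expr_diff[of a b c f g "grad f" "grad g" "hess f" "hess g" x]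
  show ?thesis by (simp add: classical_op_def op_expr_def)
qed

lemma Ld_loc_diff:
  fixes f g :: "real^'n::finite \<Rightarrow> real"
  assumes "f \<in> Ld_loc Om" and "g \<in> Ld_loc Om"
  shows "(\<lambda>x. f x - g x) \<in> Ld_loc Om"
proof -
  have fg[measurable]: "f \<in> borel_measurable (lebesgue_on Om)" "g \<in> borel_measurable (lebesgue_on Om)"
    using assms by (auto simp: Ld_loc_def)
  have "integrable (lebesgue_on C) (\<lambda>x. \<bar>f x - g x\<bar> ^ CARD('n))" if C: "compact C" "C \<subseteq> Om"
    for C :: "(real^'n) set"
  proof (rule Bochner_Integration.integrable_bound)
    let ?d = "CARD('n)"
    show "integrable (lebesgue_on C) (\<lambda>x. 2 ^ ?d * (\<bar>f x\<bar> ^ ?d + \<bar>g x\<bar> ^ ?d))"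
      using assms C by (auto simp: Ld_loc_def)
    have [measurable]: "f \<in> borel_measurable (lebesgue_on C)" "g \<in> borel_measurable (lebesgue_on C)"
      using measurable_restrict_mono[OF _ C(2)] fg by blast+
    show "(\<lambda>x. \<bar>f x - g x\<bar> ^ ?d) \<in> borel_measurable (lebesgue_on C)"
      by measurable
    have "\<bar>s - t\<bar> ^ ?d \<le> 2 ^ ?d * (\<bar>s\<bar> ^ ?d + \<bar>t\<bar> ^ ?d)" for s t :: real
    proof -
      have "\<bar>s - t\<bar> ^ ?d \<le> (2 * max \<bar>s\<bar> \<bar>t\<bar>) ^ ?d"
        by (rule power_mono) auto
      also have "\<dots> = 2 ^ ?d * max \<bar>s\<bar> \<bar>t\<bar> ^ ?d"
        by (simp add: power_mult_distrib)
      also have "\<dots> \<le> 2 ^ ?d * (\<bar>s\<bar> ^ ?d + \<bar>t\<bar> ^ ?d)"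
        by (intro mult_left_mono) (auto simp: max_def)
      finally show ?thesis .
    qed
    then show "AE x in lebesgue_on C. norm (\<bar>f x - g x\<bar> ^ ?d) \<le> norm (2 ^ ?d * (\<bar>f x\<bar> ^ ?d + \<bar>g x\<bar> ^ ?d))"
      by simp
  qed
  then show ?thesis
    by (auto simp: Ld_loc_def)
qed

text \<open>
  On the compact set \<open>C\<close>, which has finite measure, \<open>\<bar>f\<bar> \<le> 1 + \<bar>f\<bar>\<^sup>d\<close> shows that \<open>f\<close> is
  integrable, and \<open>\<psi>\<close> is bounded there. Off \<open>C\<close> the product vanishes, so integrability over \<open>C\<close>
  is integrability over the whole open set.
\<close>

lemma Ld_loc_mult_integrable:
  fixes f \<psi> :: "real^'n::finite \<Rightarrow> real"
  assumes "open Om" and f: "f \<in> Ld_loc Om" and cont: "continuous_on UNIV \<psi>"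
    and C: "compact C" "C \<subseteq> Om" and zero: "\<And>x. x \<notin> C \<Longrightarrow> \<psi> x = 0"
  shows "integrable (lebesgue_on Om) (\<lambda>x. f x * \<psi> x)"
proof -
  let ?d = "CARD('n)"
  have sets[simp]: "Om \<in> sets lebesgue" "C \<in> sets lebesgue"
    using assms(1) C by (auto simp: borel_compact)
  obtain M where M: "\<And>x. x \<in> C \<Longrightarrow> \<bar>\<psi> x\<bar> \<le> M"
    using compact_imp_bounded[OF compact_continuous_image[OF continuous_on_subset[OF cont] C(1)]]
    by (auto simp: bounded_iff)
  have f_meas[measurable]: "f \<in> borel_measurable (lebesgue_on C)"
    using f C(2) by (auto simp: Ld_loc_def intro: measurable_restrict_mono)
  have \<psi>_meas[measurable]: "\<psi> \<in> borel_measurable (lebesgue_on C)"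
    using continuous_on_subset[OF cont, of C] by (intro continuous_imp_measurable_on_sets_lebesgue) auto
  have "integrable (lebesgue_on C) (\<lambda>x. f x * \<psi> x)"
  proof (rule Bochner_Integration.integrable_bound)
    have "integrable (lebesgue_on C) (\<lambda>x. 1::real)"
      using C(1) by (intro finite_measure.integrable_const finite_measure_lebesgue_on
          lmeasurable_compact)
    then show "integrable (lebesgue_on C) (\<lambda>x. M * (1 + \<bar>f x\<bar> ^ ?d))"
      using f C by (auto simp: Ld_loc_def)
    show "(\<lambda>x. f x * \<psi> x) \<in> borel_measurable (lebesgue_on C)"
      by measurable
    have "\<bar>t\<bar> \<le> 1 + \<bar>t\<bar> ^ ?d" for t :: real
    proof (cases "\<bar>t\<bar> \<le> 1")
      case True
      then show ?thesis by (simp add: add_increasing2)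
    next
      case False
      then show ?thesis using self_le_power[of "\<bar>t\<bar>" ?d] by simp
    qed
    then have "norm (f x * \<psi> x) \<le> norm (M * (1 + \<bar>f x\<bar> ^ ?d))" if "x \<in> C" for x
    proof -
      have "norm (f x * \<psi> x) = \<bar>\<psi> x\<bar> * \<bar>f x\<bar>"
        by (simp add: abs_mult)
      also have "\<dots> \<le> M * (1 + \<bar>f x\<bar> ^ ?d)"
        using M[OF that] \<open>\<And>t. \<bar>t\<bar> \<le> 1 + \<bar>t\<bar> ^ ?d\<close> by (intro mult_mono) auto
      also have "\<dots> \<le> norm (M * (1 + \<bar>f x\<bar> ^ ?d))"
        unfolding real_norm_def by (rule abs_ge_self)
      finally show ?thesis .
    qed
    then show "AE x in lebesgue_on C. norm (f x * \<psi> x) \<le> norm (M * (1 + \<bar>f x\<bar> ^ ?d))"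
      by (intro AE_I2) simp
  qed
  then have "integrable lebesgue (\<lambda>x. indicator C x *\<^sub>R (f x * \<psi> x))"
    by (simp add: integrable_restrict_space)
  also have "(\<lambda>x. indicator C x *\<^sub>R (f x * \<psi> x)) = (\<lambda>x. indicator Om x *\<^sub>R (f x * \<psi> x))"
    using zero C(2) by (auto simp: indicator_def fun_eq_iff)
  finally show ?thesis
    by (simp add: integrable_restrict_space)
qed

text \<open>
  These are the integrals in the definition of a weak partial derivative. A partial derivative of a
  test function vanishes off the support too, because the test function is zero near every such
  point.
\<close>

lemma test_function_integrable:
  assumes "open Om" and "f \<in> Ld_loc Om" and phi: "\<phi> \<in> test_functions Om"
  shows "integrable (lebesgue_on Om) (\<lambda>x. f x * \<phi> x)"
    and "integrable (lebesgue_on Om) (\<lambda>x. f x * partial i \<phi> x)"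
proof -
  let ?C = "closure {x. \<phi> x \<noteq> 0}"
  have C: "compact ?C" "?C \<subseteq> Om" and Ck: "Ck 0 \<phi>" "Ck (Suc 0) \<phi>"
    using phi by (auto simp only: test_functions_def mem_Collect_eq)
  have zero: "\<phi> x = 0" if "x \<notin> ?C" for x
    using that closure_subset[of "{x. \<phi> x \<noteq> 0}"] by blast
  show "integrable (lebesgue_on Om) (\<lambda>x. f x * \<phi> x)"
    by (rule Ld_loc_mult_integrable[OF assms(1,2) _ C zero]) (use Ck in simp)
  have zero': "partial i \<phi> x = 0" if "x \<notin> ?C" for x
  proof -
    have "partial i \<phi> x = partial i (\<lambda>y. 0) x"
    proof (rule partial_cong_open)
      show "open (- ?C)" by (intro open_Compl closed_closure)
      show "x \<in> - ?C" using that by blast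
      show "\<phi> y = 0" if "y \<in> - ?C" for y
        using that by (intro zero) blast
    qed
    then show ?thesis by (simp add: partial_def)
  qed
  show "integrable (lebesgue_on Om) (\<lambda>x. f x * partial i \<phi> x)"
    by (rule Ld_loc_mult_integrable[OF assms(1,2) _ C zero']) (use Ck in simp)
qed

lemma weak_partial_diff:
  assumes "open Om" and "f \<in> Ld_loc Om" "g \<in> Ld_loc Om" "f' \<in> Ld_loc Om" "g' \<in> Ld_loc Om"
    and "weak_partial Om i f f'" and "weak_partial Om i g g'"
  shows "weak_partial Om i (\<lambda>x. f x - g x) (\<lambda>x. f' x - g' x)"
  using assms by (simp add: weak_partial_def left_diff_distrib test_function_integrable)

lemma has_W2d_derivs_diff:
  assumes "open Om" and "has_W2d_derivs Om f G H" and "has_W2d_derivs Om g G' H'"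
  shows "has_W2d_derivs Om (\<lambda>x. f x - g x) (\<lambda>x. G x - G' x) (\<lambda>x. H x - H' x)"
  using assms by (simp add: has_W2d_derivs_def Ld_loc_diff weak_partial_diff)

lemma has_strong_op_diff:
  assumes "open Om" and "has_strong_op Om a b c f F" and "has_strong_op Om a b c g F'"
  shows "has_strong_op Om a b c (\<lambda>x. f x - g x) (\<lambda>x. F x - F' x)"
proof -
  obtain G H G' H' where
    "has_W2d_derivs Om f G H" "F = op_expr a b c f G H"
    "has_W2d_derivs Om g G' H'" "F' = op_expr a b c g G' H'"
    using assms(2,3) by (auto simp: has_strong_op_def)
  with has_W2d_derivs_diff[OF assms(1)] show ?thesis
    unfolding has_strong_op_def
    by (intro exI[of _ "\<lambda>x. G x - G' x"] exI[of _ "\<lambda>x. H x - H' x"]) (simp add: op_expr_diff fun_eq_iff)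
qed

section \<open>Comparison\<close>

lemma convex_cone_add_uminus:
  assumes "convex_cone_of_functions K" and "u \<in> K" and "(\<lambda>x. - v x) \<in> K"
  shows "(\<lambda>x. u x - v x) \<in> K"
proof -
  have "(\<lambda>x. 1 * u x + 1 * - v x) \<in> K"
    using assms unfolding convex_cone_of_functions_def by (metis zero_less_one)
  then show ?thesis by simp
qed

lemma comparison_C2:
  assumes "open Om" and "weak_max_principle_C2 Om S K a b c"
    and "u \<in> C2 Om" and "v \<in> C2 Om" and "(\<lambda>x. u x - v x) \<in> K"
    and "\<forall>x\<in>Om. classical_op a b c u x \<le> classical_op a b c v x"
    and "env_le_on Om (frontier Om - closure S) u v"
  shows "\<forall>x\<in>Om. u x \<le> v x"
proof -
  have "\<forall>x\<in>Om. classical_op a b c (\<lambda>x. u x - v x) x \<le> 0"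
    using assms by (simp add: classical_op_diff)
  moreover have "\<forall>x\<in>frontier Om - closure S. upper_env Om (\<lambda>x. u x - v x) x \<le> 0"
    using assms(7) by (auto simp: env_le_on_def intro!: upper_env_diff_le_zero)
  ultimately have "\<forall>x\<in>Om. u x - v x \<le> 0"
    using bspec[OF assms(2)[unfolded weak_max_principle_C2_def] assms(5)] by blast
  then show ?thesis by simp
qed

lemma comparison_W2d:
  assumes "open Om" and "weak_max_principle_W2d Om S K a b c"
    and "has_strong_op Om a b c u Au" and "has_strong_op Om a b c v Av"
    and "(\<lambda>x. u x - v x) \<in> K"
    and "AE x in lebesgue_on Om. Au x \<le> Av x"
    and "env_le_on Om (frontier Om - closure S) u v"
  shows "\<forall>x\<in>Om. u x \<le> v x"
proof -
  have "AE x in lebesgue_on Om. Au x - Av x \<le> 0"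
    using assms(6) by simp
  moreover have "\<forall>x\<in>frontier Om - closure S. upper_env Om (\<lambda>x. u x - v x) x \<le> 0"
    using assms(7) by (auto simp: env_le_on_def intro!: upper_env_diff_le_zero)
  ultimately have "\<forall>x\<in>Om. u x - v x \<le> 0"
    using has_strong_op_diff[OF assms(1,3,4)]
    by (intro mp[OF spec[OF bspec[OF assms(2)[unfolded weak_max_principle_W2d_def] assms(5)]]] conjI)
  then show ?thesis by simp
qed

text \<open>
  The membership of \<open>v - u\<close> in the cone and \<open>v\<^sup>* \<le> u\<^sub>*\<close> serve the reverse comparison; the
  continuous extension comes from \<open>u\<^sup>* = v\<^sub>* = u\<^sub>*\<close> on the boundary portion.
\<close>

lemma uniqueness_C2:
  assumes "open Om" and "weak_max_principle_C2 Om S K a b c"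
    and "u \<in> C2 Om" and "v \<in> C2 Om" and "(\<lambda>x. u x - v x) \<in> K" and "(\<lambda>x. v x - u x) \<in> K"
    and "\<forall>x\<in>Om. classical_op a b c u x = classical_op a b c v x"
    and "env_eq_on Om (frontier Om - closure S) u v"
    and "env_le_on Om (frontier Om - closure S) v u"
  shows "(\<forall>x\<in>Om. u x = v x) \<and> extends_continuously Om (Om \<union> (frontier Om - closure S)) u"
proof -
  have "\<forall>x\<in>Om. u x \<le> v x"
    by (rule comparison_C2[OF assms(1,2,3,4,5) _ env_eq_imp_le[OF assms(8)]]) (use assms(7) in auto)
  moreover have "\<forall>x\<in>Om. v x \<le> u x"
    by (rule comparison_C2[OF assms(1,2,4,3,6) _ assms(9)]) (use assms(7) in auto)
  ultimately have eq: "\<forall>x\<in>Om. u x = v x"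
    by (intro ballI order_antisym) (erule bspec, assumption)+
  have "continuous_on Om u"
  proof (intro continuous_at_imp_continuous_on ballI differentiable_imp_continuous_within)
    show "u differentiable at x" if "x \<in> Om" for x
      using assms(3) that by (simp add: C2_def)
  qed
  moreover have "frontier Om - closure S \<subseteq> closure Om"
    by (auto simp: frontier_def)
  ultimately have "extends_continuously Om (Om \<union> (frontier Om - closure S)) u"
    by (intro extends_continuously_by_envelopes[OF _ bspec[OF eq] _ assms(8)])
  with eq show ?thesis ..
qed

lemma uniqueness_W2d:
  assumes "open Om" and "weak_max_principle_W2d Om S K a b c"
    and "continuous_on Om u" and "has_strong_op Om a b c u Au" and "has_strong_op Om a b c v Av"
    and "(\<lambda>x. u x - v x) \<in> K" and "(\<lambda>x. v x - u x) \<in> K"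
    and "AE x in lebesgue_on Om. Au x = Av x"
    and "env_eq_on Om (frontier Om - closure S) u v"
    and "env_le_on Om (frontier Om - closure S) v u"
  shows "(\<forall>x\<in>Om. u x = v x) \<and> extends_continuously Om (Om \<union> (frontier Om - closure S)) u"
proof -
  have "\<forall>x\<in>Om. u x \<le> v x"
    by (rule comparison_W2d[OF assms(1,2,4,5,6) _ env_eq_imp_le[OF assms(9)]]) (use assms(8) in auto)
  moreover have "\<forall>x\<in>Om. v x \<le> u x"
    by (rule comparison_W2d[OF assms(1,2,5,4,7) _ assms(10)]) (use assms(8) in auto)
  ultimately have eq: "\<forall>x\<in>Om. u x = v x"
    by (intro ballI order_antisym) (erule bspec, assumption)+
  have "frontier Om - closure S \<subseteq> closure Om"
    by (auto simp: frontier_def)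
  then have "extends_continuously Om (Om \<union> (frontier Om - closure S)) u"
    by (intro extends_continuously_by_envelopes[OF assms(3) bspec[OF eq] _ assms(9)])
  with eq show ?thesis ..
qed

theorem proposition2p1:
  fixes Om S :: "(real^'n::finite) set"
    and K :: "(real^'n \<Rightarrow> real) set"
    and a :: "real^'n \<Rightarrow> real^'n^'n"
    and b :: "real^'n \<Rightarrow> real^'n"
    and c u v :: "real^'n \<Rightarrow> real"
  assumes "open Om"
    and "openin (top_of_set (frontier Om)) S"
    and "coeff_nonneg Om a"
    and "convex_cone_of_functions K"
    and "u \<in> K" and "(\<lambda>x. - v x) \<in> K"
  shows
    "(K \<subseteq> C2 Om \<and> weak_max_principle_C2 Om S K a b c \<longrightarrow>
        ((\<forall>x\<in>Om. classical_op a b c u x \<le> classical_op a b c v x) \<and>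
         env_le_on Om (frontier Om - closure S) u v
         \<longrightarrow> (\<forall>x\<in>Om. u x \<le> v x)) \<and>
        ((\<forall>x\<in>Om. classical_op a b c u x = classical_op a b c v x) \<and>
         env_eq_on Om (frontier Om - closure S) u v \<and>
         env_le_on Om (frontier Om - closure S) v u \<and> (\<lambda>x. v x - u x) \<in> K
         \<longrightarrow> (\<forall>x\<in>Om. u x = v x) \<and>
             extends_continuously Om (Om \<union> (frontier Om - closure S)) u))
     \<and>
     (K \<subseteq> W2d_loc Om \<and>
      a \<in> borel_measurable (lebesgue_on Om) \<and>
      b \<in> borel_measurable (lebesgue_on Om) \<and>
      c \<in> borel_measurable (lebesgue_on Om) \<and>
      weak_max_principle_W2d Om S K a b c \<longrightarrow>
        (\<forall>Au Av. has_strong_op Om a b c u Au \<and> has_strong_op Om a b c v Av \<longrightarrow>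
          ((AE x in lebesgue_on Om. Au x \<le> Av x) \<and>
           env_le_on Om (frontier Om - closure S) u v
           \<longrightarrow> (\<forall>x\<in>Om. u x \<le> v x)) \<and>
          ((AE x in lebesgue_on Om. Au x = Av x) \<and>
           env_eq_on Om (frontier Om - closure S) u v \<and>
           env_le_on Om (frontier Om - closure S) v u \<and> (\<lambda>x. v x - u x) \<in> K
           \<longrightarrow> (\<forall>x\<in>Om. u x = v x) \<and>
               extends_continuously Om (Om \<union> (frontier Om - closure S)) u)))"
proof -
  let ?B = "frontier Om - closure S"
  have uv_K: "(\<lambda>x. u x - v x) \<in> K"
    by (rule convex_cone_add_uminus[OF assms(4-6)])
  have C2: "u \<in> C2 Om" "v \<in> C2 Om" if "K \<subseteq> C2 Om"
    using that assms(5,6) C2_uminus_cancel[OF assms(1)] by auto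
  have W2d: "continuous_on Om u" if "K \<subseteq> W2d_loc Om"
    using that assms(5) by (auto simp: W2d_loc_def)
  show ?thesis
    apply (intro conjI[of "_ \<longrightarrow> _" "_ \<longrightarrow> _"] impI allI; elim conjE)
    subgoal by (rule comparison_C2[OF assms(1) _ C2 uv_K])
    subgoal by (rule uniqueness_C2[OF assms(1) _ C2 uv_K])
    subgoal by (rule comparison_W2d[OF assms(1) _ _ _ uv_K])
    subgoal by (rule uniqueness_W2d[OF assms(1) _ W2d _ _ uv_K])
    done
qed

end
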